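(* Let the FISST prior pdf be $p(\{X\})=\sum_{i}\omega_i\,p_i(\{X\})$, where $\omega_i\ge 0$, $\sum_i\omega_i=1$, and each $p_i$ is an $n$-target FISST pdf $p_i(\{x_1,\dots,x_n\})=\sum_{\bar\sigma}p^i_{\sigma_1}(x_1)\cdots p^i_{\sigma_n}(x_n)$. Let there be no target birth or death, and let the observation be $\{z_1,\dots,z_m\}$. Then: (1) the FISST predicted pdf of the $i$-th component is $$p_i^-(\{x_1,\dots,x_n\})=\sum_{\bar\sigma}p^{i-}_{\sigma_1}(x_1)\cdots p^{i-}_{\sigma_n}(x_n),\qquad p_k^{i-}(x)=\int p(x/x')\,p_k^i(x')\,dx';$$ (2) the FISST updated pdf is the sum over all components $i$ and all data associations $j$ of the components $$p_{ij}(\{x_1,\dots,x_n\})=\frac{\omega_i\,p_{ij}\,l_{ij}}{\sum_{i',j'}l_{i'j'}\,p_{i'j'}\,\omega_{i'}}\Big\{\sum_{\bar\sigma}p_1^{ij}(x_{\sigma_1})\,p_2^{ij}(x_{\sigma_2})\cdots p_n^{ij}(x_{\sigma_n})\Big\},$$ where $p_1^{ij}(x_1)\cdots p_n^{ij}(x_n)$ is the updated multi-target pdf obtained by using the $j$-th data association for component $i$. That is, the FISST recursion yields the same weights $\omega_ip_{ij}l_{ij}/\sum_{i',j'}\omega_{i'}p_{i'j'}l_{i'j'}$ and the same multi-target pdfs as the hypothesis level (H-FISST) recursion, up to summation over permutations of the arguments.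
   Context: FISST (finite set statistics) multi-target pdfs are symmetric functions of their arguments $x_1,\dots,x_n$; $\bar\sigma=(\sigma_1,\dots,\sigma_n)$ ranges over all permutations of $\{1,\dots,n\}$, and integrals over multi-target states $\{x_1,\dots,x_n\}$ carry the factor $\frac{1}{n!}$. Each $p_k^i$ is a pdf on the single-target state space. Notation: "$a/b$" inside $p(\cdot)$ means $a$ conditioned on $b$. Prediction: $p(x/x')$ is the single-target transition pdf, the same for all targets, and the FISST transition pdf is $p(\{x_1,\dots,x_n\}/\{x'_1,\dots,x'_n\})=\sum_{\bar\sigma}\prod_{k=1}^n p(x_k/x'_{\sigma_k})$. The FISST predicted pdf of component $i$ is $\frac1{n!}\int p(\{x_1,\dots,x_n\}/\{x_1',\dots,x_n'\})\,p_i(\{x_1',\dots,x_n'\})\,dx_1'\cdots dx_n'$. Measurement model: $p(z/x)$ is the single-target likelihood, $g(z)$ the probability (density) of getting $z$ from clutter, $p_D$ the probability of detection. A data association $j$ assigns each measurement $z_l$ either to a target $j_l\in\{1,\dots,n\}$ or to clutter, with each target receiving at most one measurement. If $k$ targets are associated to measurements under $j$, put $$p_{ij}=\frac{p_D^k(1-p_D)^{n-k}}{\binom mk k!}$$ (without arguments, $p_{ij}$ always denotes this number; with argument $\{x_1,\dots,x_n\}$ it denotes the component of the updated pdf). The FISST likelihood is $$p(\{z_1,\dots,z_m\}/\{x_1,\dots,x_n\})=\sum_j p_{ij}\prod_{l:\,z_l\to\text{target } j_l}p(z_l/x_{j_l})\prod_{l:\,z_l\to\text{clutter}}g(z_l),$$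 the sum being over all data associations $j$. Update: the FISST updated pdf is $$\frac1\eta\sum_i\omega_i\,p(\{z_1,\dots,z_m\}/\{x_1,\dots,x_n\})\,p_i^-(\{x_1,\dots,x_n\}),$$ where $\eta$ is the normalization factor making its integral (with factor $\frac1{n!}$) equal to $1$. Hypothesis level (H-FISST) quantities: for component (hypothesis) $i$ and data association $j$, $$l_{ij}=\prod_{l:\,z_l\to\text{target } j_l}\int p(z_l/x)\,p^{i-}_{j_l}(x)\,dx\prod_{l:\,z_l\to\text{clutter}}g(z_l),$$ and $p_k^{ij}(x)=p(z_l/x)p_k^{i-}(x)\big/\int p(z_l/x')p_k^{i-}(x')dx'$ if target $k$ is assigned measurement $z_l$ under $j$, while $p_k^{ij}=p_k^{i-}$ if target $k$ is assigned no measurement. The H-FISST recursion represents hypothesis $i$ by the weight $\omega_i$ and the labelled multi-target pdf $\prod_{k=1}^n p_k^i(x_k)$; it predicts the latter to $\prod_k p_k^{i-}(x_k)$, and updates to the children $(i,j)$ with multi-target pdfs $\prod_k p_k^{ij}(x_k)$ and weights $\omega_ip_{ij}l_{ij}/\sum_{i',j'}\omega_{i'}p_{i'j'}l_{i'j'}$. All normalizing denominators are taken to be positive. *)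

theory Defs
  imports "HOL-Probability.Probability" "HOL-Combinatorics.Permutations"
begin

text \<open>
  Densities are taken with respect to a reference measure \<open>M\<close> on the single-target state space
  and are \<open>ennreal\<close>-valued, as for \<open>distributed\<close>. So the integrals below exist at every point,
  although, e.g., the integral over \<open>x'\<close> of \<open>p(x/x') q(x')\<close> is in general finite only for
  almost every \<open>x\<close>.

  A multi-target state with \<open>n\<close> targets is a point \<open>x\<close> of the product space
  \<open>Pi\<^sub>M {1..n} (\<lambda>_. M)\<close>, and a FISST pdf is a symmetric function of \<open>x 1, \<dots>, x n\<close>.
\<close>

definition is_pdf :: "'a measure \<Rightarrow> ('a \<Rightarrow> ennreal) \<Rightarrow> bool" where
  "is_pdf M f \<longleftrightarrow> f \<in> borel_measurable M \<and> (\<integral>\<^sup>+x. f x \<partial>M) = 1"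

abbreviation multi_space :: "'a measure \<Rightarrow> nat \<Rightarrow> (nat \<Rightarrow> 'a) measure" where
  "multi_space M n \<equiv> Pi\<^sub>M {1..n} (\<lambda>_. M)"

definition fisst_integral :: "'a measure \<Rightarrow> nat \<Rightarrow> ((nat \<Rightarrow> 'a) \<Rightarrow> ennreal) \<Rightarrow> ennreal" where
  "fisst_integral M n f = 1 / of_nat (fact n) * (\<integral>\<^sup>+x. f x \<partial>multi_space M n)"

definition fisst_pdf :: "nat \<Rightarrow> (nat \<Rightarrow> 'a \<Rightarrow> ennreal) \<Rightarrow> (nat \<Rightarrow> 'a) \<Rightarrow> ennreal" where
  "fisst_pdf n q x = (\<Sum>\<sigma> | \<sigma> permutes {1..n}. \<Prod>k\<in>{1..n}. q (\<sigma> k) (x k))"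

definition mixture :: "'i set \<Rightarrow> ('i \<Rightarrow> real) \<Rightarrow> ('i \<Rightarrow> (nat \<Rightarrow> 'a) \<Rightarrow> ennreal) \<Rightarrow> (nat \<Rightarrow> 'a) \<Rightarrow> ennreal" where
  "mixture I \<omega> P x = (\<Sum>i\<in>I. ennreal (\<omega> i) * P i x)"


subsection \<open>Prediction\<close>

text \<open>\<open>trans_pdf x x'\<close> is \<open>p(x/x')\<close>, the density of moving to \<open>x\<close> from \<open>x'\<close>.\<close>

definition fisst_trans ::
  "('a \<Rightarrow> 'a \<Rightarrow> ennreal) \<Rightarrow> nat \<Rightarrow> (nat \<Rightarrow> 'a) \<Rightarrow> (nat \<Rightarrow> 'a) \<Rightarrow> ennreal" where
  "fisst_trans trans_pdf n x x' = (\<Sum>\<sigma> | \<sigma> permutes {1..n}. \<Prod>k\<in>{1..n}. trans_pdf (x k) (x' (\<sigma> k)))"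

definition fisst_predict ::
  "'a measure \<Rightarrow> ('a \<Rightarrow> 'a \<Rightarrow> ennreal) \<Rightarrow> nat \<Rightarrow> ((nat \<Rightarrow> 'a) \<Rightarrow> ennreal) \<Rightarrow> (nat \<Rightarrow> 'a) \<Rightarrow> ennreal" where
  "fisst_predict M trans_pdf n f x = fisst_integral M n (\<lambda>x'. fisst_trans trans_pdf n x x' * f x')"

definition target_predict ::
  "'a measure \<Rightarrow> ('a \<Rightarrow> 'a \<Rightarrow> ennreal) \<Rightarrow> (nat \<Rightarrow> 'a \<Rightarrow> ennreal) \<Rightarrow> nat \<Rightarrow> 'a \<Rightarrow> ennreal" where
  "target_predict M trans_pdf q k x = (\<integral>\<^sup>+x'. trans_pdf x x' * q k x' \<partial>M)"


subsection \<open>Data associations and the FISST update\<close>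

text \<open>
  In a data association \<open>j\<close>, \<open>j l = Some k\<close> means that measurement \<open>l\<close> is assigned to target \<open>k\<close>,
  and \<open>j l = None\<close> with \<open>l \<in> {1..m}\<close> that it is assigned to clutter. Thus \<open>dom j\<close> is the set of
  measurements assigned to targets, and its cardinality is the number of detected targets.
\<close>

definition data_assocs :: "nat \<Rightarrow> nat \<Rightarrow> (nat \<rightharpoonup> nat) set" where
  "data_assocs n m = {j. dom j \<subseteq> {1..m} \<and> ran j \<subseteq> {1..n} \<and> inj_on j (dom j)}"

definition assoc_prob :: "real \<Rightarrow> nat \<Rightarrow> nat \<Rightarrow> (nat \<rightharpoonup> nat) \<Rightarrow> real" where
  "assoc_prob pD n m j =
     (let k = card (dom j) in pD ^ k * (1 - pD) ^ (n - k) / (real (m choose k) * fact k))"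

definition fisst_lik ::
  "('z \<Rightarrow> 'a \<Rightarrow> ennreal) \<Rightarrow> ('z \<Rightarrow> ennreal) \<Rightarrow> real \<Rightarrow> nat \<Rightarrow> nat \<Rightarrow> (nat \<Rightarrow> 'z) \<Rightarrow> (nat \<Rightarrow> 'a) \<Rightarrow> ennreal" where
  "fisst_lik lik g pD n m z x =
     (\<Sum>j\<in>data_assocs n m. ennreal (assoc_prob pD n m j)
        * (\<Prod>l\<in>dom j. lik (z l) (x (the (j l)))) * (\<Prod>l\<in>{1..m} - dom j. g (z l)))"

definition fisst_normalize :: "'a measure \<Rightarrow> nat \<Rightarrow> ((nat \<Rightarrow> 'a) \<Rightarrow> ennreal) \<Rightarrow> (nat \<Rightarrow> 'a) \<Rightarrow> ennreal" where
  "fisst_normalize M n f x = 1 / fisst_integral M n f * f x"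

lemma fisst_integral_normalize:
  assumes "f \<in> borel_measurable (multi_space M n)"
    and "0 < fisst_integral M n f" "fisst_integral M n f < \<infinity>"
  shows "fisst_integral M n (fisst_normalize M n f) = 1"
proof -
  have "fisst_integral M n (fisst_normalize M n f)
      = 1 / fisst_integral M n f * fisst_integral M n f"
    unfolding fisst_integral_def[of M n "fisst_normalize M n f"] fisst_normalize_def
    by (subst nn_integral_cmult[OF assms(1)]) (simp add: fisst_integral_def mult_ac)
  also have "\<dots> = 1"
    using assms(2,3)
    by (metis ennreal_divide_self ennreal_times_divide infinity_ennreal_def less_irrefl
        mult.commute mult.right_neutral)
  finally show ?thesis .
qed

text \<open>\<open>P i\<close> is the predicted FISST pdf of component \<open>i\<close>.\<close>

definition fisst_update ::
  "'a measure \<Rightarrow> ('z \<Rightarrow> 'a \<Rightarrow> ennreal) \<Rightarrow> ('z \<Rightarrow> ennreal) \<Rightarrow> real \<Rightarrow> nat \<Rightarrow> nat \<Rightarrow> (nat \<Rightarrow> 'z)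
    \<Rightarrow> 'i set \<Rightarrow> ('i \<Rightarrow> real) \<Rightarrow> ('i \<Rightarrow> (nat \<Rightarrow> 'a) \<Rightarrow> ennreal) \<Rightarrow> (nat \<Rightarrow> 'a) \<Rightarrow> ennreal" where
  "fisst_update M lik g pD n m z I \<omega> P =
     fisst_normalize M n (\<lambda>x. \<Sum>i\<in>I. ennreal (\<omega> i) * fisst_lik lik g pD n m z x * P i x)"


subsection \<open>The hypothesis level recursion\<close>

text \<open>
  Here \<open>q\<close> is the family of predicted single-target pdfs of one hypothesis, and \<open>Q i\<close> that of
  hypothesis \<open>i\<close>.
\<close>

definition hyp_lik ::
  "'a measure \<Rightarrow> ('z \<Rightarrow> 'a \<Rightarrow> ennreal) \<Rightarrow> ('z \<Rightarrow> ennreal) \<Rightarrow> nat \<Rightarrow> (nat \<Rightarrow> 'z)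
    \<Rightarrow> (nat \<Rightarrow> 'a \<Rightarrow> ennreal) \<Rightarrow> (nat \<rightharpoonup> nat) \<Rightarrow> ennreal" where
  "hyp_lik M lik g m z q j =
     (\<Prod>l\<in>dom j. \<integral>\<^sup>+x. lik (z l) x * q (the (j l)) x \<partial>M) * (\<Prod>l\<in>{1..m} - dom j. g (z l))"

definition target_update ::
  "'a measure \<Rightarrow> ('z \<Rightarrow> 'a \<Rightarrow> ennreal) \<Rightarrow> (nat \<Rightarrow> 'z) \<Rightarrow> (nat \<Rightarrow> 'a \<Rightarrow> ennreal)
    \<Rightarrow> (nat \<rightharpoonup> nat) \<Rightarrow> nat \<Rightarrow> 'a \<Rightarrow> ennreal" where
  "target_update M lik z q j k x =
     (if k \<in> ran j
      then let l = (THE l. j l = Some k)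
           in lik (z l) x * q k x / (\<integral>\<^sup>+x'. lik (z l) x' * q k x' \<partial>M)
      else q k x)"

definition total_weight ::
  "'a measure \<Rightarrow> ('z \<Rightarrow> 'a \<Rightarrow> ennreal) \<Rightarrow> ('z \<Rightarrow> ennreal) \<Rightarrow> real \<Rightarrow> nat \<Rightarrow> nat \<Rightarrow> (nat \<Rightarrow> 'z)
    \<Rightarrow> 'i set \<Rightarrow> ('i \<Rightarrow> real) \<Rightarrow> ('i \<Rightarrow> nat \<Rightarrow> 'a \<Rightarrow> ennreal) \<Rightarrow> ennreal" where
  "total_weight M lik g pD n m z I \<omega> Q =
     (\<Sum>i\<in>I. \<Sum>j\<in>data_assocs n m.
        hyp_lik M lik g m z (Q i) j * ennreal (assoc_prob pD n m j) * ennreal (\<omega> i))"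

definition labelled_pdf :: "nat \<Rightarrow> (nat \<Rightarrow> 'a \<Rightarrow> ennreal) \<Rightarrow> (nat \<Rightarrow> 'a) \<Rightarrow> ennreal" where
  "labelled_pdf n q x = (\<Prod>k\<in>{1..n}. q k (x k))"

text \<open>Maps a child \<open>(i, j)\<close> to its weight and its labelled multi-target pdf.\<close>

definition hfisst_update ::
  "'a measure \<Rightarrow> ('z \<Rightarrow> 'a \<Rightarrow> ennreal) \<Rightarrow> ('z \<Rightarrow> ennreal) \<Rightarrow> real \<Rightarrow> nat \<Rightarrow> nat \<Rightarrow> (nat \<Rightarrow> 'z)
    \<Rightarrow> 'i set \<Rightarrow> ('i \<Rightarrow> real) \<Rightarrow> ('i \<Rightarrow> nat \<Rightarrow> 'a \<Rightarrow> ennreal)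
    \<Rightarrow> 'i \<times> (nat \<rightharpoonup> nat) \<Rightarrow> ennreal \<times> ((nat \<Rightarrow> 'a) \<Rightarrow> ennreal)" where
  "hfisst_update M lik g pD n m z I \<omega> Q = (\<lambda>(i, j).
     (ennreal (\<omega> i) * ennreal (assoc_prob pD n m j) * hyp_lik M lik g m z (Q i) j
        / total_weight M lik g pD n m z I \<omega> Q,
      labelled_pdf n (target_update M lik z (Q i) j)))"

definition symmetrize :: "nat \<Rightarrow> ((nat \<Rightarrow> 'a) \<Rightarrow> ennreal) \<Rightarrow> (nat \<Rightarrow> 'a) \<Rightarrow> ennreal" where
  "symmetrize n F x = (\<Sum>\<sigma> | \<sigma> permutes {1..n}. F (\<lambda>k. x (\<sigma> k)))"

end

theory Submission
  imports Defs
begin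

text \<open>
  Relabelling the targets by \<open>\<sigma>\<close> permutes the data associations without changing their
  probabilities, so the FISST likelihood is a symmetric function of the targets. It can therefore
  be moved inside the sum over permutations that defines the predicted pdf, where every summand
  is the labelled H-FISST update. Prediction is similar: composing the permutation of the transition pdf with
  that of the prior yields every permutation \<open>n!\<close> times. The single-target factors all
  integrate to one, so the normalization factor is the total weight of the hypotheses.
\<close>

section \<open>Sums over permutations and the factor \<open>1 / n!\<close>\<close>

lemma symmetrize_labelled_pdf: "symmetrize n (labelled_pdf n q) x = fisst_pdf n q x"
proof -
  \<comment> \<open>Replacing each permutation by its inverse and then reindexing the product moves
    the permutation from the arguments to the labels.\<close>
  have "symmetrize n (labelled_pdf n q) x
      = (\<Sum>\<sigma> | \<sigma> permutes {1..n}. \<Prod>k\<in>{1..n}. q k (x (inv \<sigma> k)))"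
    unfolding symmetrize_def labelled_pdf_def by (rule sum_permutations_inverse)
  also have "\<dots> = fisst_pdf n q x"
    unfolding fisst_pdf_def
  proof (intro sum.cong refl)
    fix \<sigma> assume "\<sigma> \<in> {\<sigma>. \<sigma> permutes {1..n}}"
    then have \<sigma>: "\<sigma> permutes {1..n}" by simp
    show "(\<Prod>k\<in>{1..n}. q k (x (inv \<sigma> k))) = (\<Prod>k\<in>{1..n}. q (\<sigma> k) (x k))"
      by (subst prod.permute[OF \<sigma>]) (simp add: permutes_inverses[OF \<sigma>])
  qed
  finally show ?thesis .
qed

lemma card_permutes_Icc: "card {\<sigma>. \<sigma> permutes {1..n::nat}} = fact n"
  by (simp add: card_permutations)

text \<open>Cancels the factor in \<open>fisst_integral\<close> against \<open>n!\<close> equal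
  contributions. Since \<open>n!\<close> is positive and finite, this is valid in
  \<open>ennreal\<close> even for infinite \<open>c\<close>.\<close>

lemma of_nat_fact_cancel: "1 / of_nat (fact n) * (of_nat (fact n) * c) = (c::ennreal)"
proof -
  have "(of_nat (fact n) :: ennreal) \<noteq> 0"
    by (simp only: of_nat_eq_0_iff fact_nonzero not_False_eq_True)
  then have "c * of_nat (fact n) / of_nat (fact n) = c"
    by (rule mult_divide_eq_ennreal) (rule ennreal_of_nat_neq_top)
  then show ?thesis
    by (simp only: ennreal_divide_times mult_1 mult.commute[of "of_nat (fact n)" c])
qed

section \<open>Measurability and integrals of product densities\<close>

context sigma_finite_measure
begin

lemma nn_integral_labelled_pdf:
  assumes "\<And>k. k \<in> {1..n} \<Longrightarrow> q k \<in> borel_measurable M"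
  shows "(\<integral>\<^sup>+x. labelled_pdf n q x \<partial>multi_space M n) = (\<Prod>k\<in>{1..n}. \<integral>\<^sup>+x. q k x \<partial>M)"
proof -
  interpret product_sigma_finite "\<lambda>_::nat. M" by standard
  show ?thesis
    unfolding labelled_pdf_def by (rule product_nn_integral_prod) (use assms in auto)
qed

lemma borel_measurable_labelled_pdf:
  assumes "\<And>k. k \<in> {1..n} \<Longrightarrow> q k \<in> borel_measurable M"
  shows "labelled_pdf n q \<in> borel_measurable (multi_space M n)"
  unfolding labelled_pdf_def[abs_def]
proof (intro borel_measurable_prod_ennreal)
  fix k assume k: "k \<in> {1..n}"
  show "(\<lambda>x. q k (x k)) \<in> borel_measurable (multi_space M n)"
    by (rule measurable_compose[OF measurable_component_singleton[OF k] assms[OF k]])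
qed

lemma borel_measurable_fisst_pdf:
  assumes "\<And>k. k \<in> {1..n} \<Longrightarrow> q k \<in> borel_measurable M"
  shows "fisst_pdf n q \<in> borel_measurable (multi_space M n)"
proof -
  have "(\<lambda>x. \<Sum>\<sigma> | \<sigma> permutes {1..n}. labelled_pdf n (\<lambda>k. q (\<sigma> k)) x)
      \<in> borel_measurable (multi_space M n)"
  proof (intro borel_measurable_sum borel_measurable_labelled_pdf assms)
    fix \<sigma> k assume "\<sigma> \<in> {\<sigma>. \<sigma> permutes {1..n}}" "k \<in> {1..n}"
    then show "\<sigma> k \<in> {1..n}" by (metis mem_Collect_eq permutes_in_image)
  qed
  then show ?thesis by (simp add: fisst_pdf_def[abs_def] labelled_pdf_def)
qed

text \<open>Each of the \<open>n!\<close> permutations contributes a product density of integral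
  one. Applied to the updated children, this later identifies the normalization factor.\<close>

lemma fisst_integral_fisst_pdf:
  assumes "\<And>k. k \<in> {1..n} \<Longrightarrow> is_pdf M (q k)"
  shows "fisst_integral M n (fisst_pdf n q) = 1"
proof -
  have "(\<integral>\<^sup>+x. fisst_pdf n q x \<partial>multi_space M n)
      = (\<integral>\<^sup>+x. (\<Sum>\<sigma> | \<sigma> permutes {1..n}. labelled_pdf n (\<lambda>k. q (\<sigma> k)) x) \<partial>multi_space M n)"
    by (simp add: fisst_pdf_def labelled_pdf_def)
  also have "\<dots> = (\<Sum>\<sigma> | \<sigma> permutes {1..n}. \<integral>\<^sup>+x. labelled_pdf n (\<lambda>k. q (\<sigma> k)) x \<partial>multi_space M n)"
  proof (rule nn_integral_sum)
    fix \<sigma> assume "\<sigma> \<in> {\<sigma>. \<sigma> permutes {1..n}}"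
    then have "q (\<sigma> k) \<in> borel_measurable M" if "k \<in> {1..n}" for k
      using assms that by (metis is_pdf_def mem_Collect_eq permutes_in_image)
    then show "labelled_pdf n (\<lambda>k. q (\<sigma> k)) \<in> borel_measurable (multi_space M n)"
      by (rule borel_measurable_labelled_pdf)
  qed
  also have "\<dots> = (\<Sum>\<sigma> | \<sigma> permutes {1..n}. 1)"
  proof (intro sum.cong refl)
    fix \<sigma> assume "\<sigma> \<in> {\<sigma>. \<sigma> permutes {1..n}}"
    then have "is_pdf M (q (\<sigma> k))" if "k \<in> {1..n}" for k
      using assms that by (metis mem_Collect_eq permutes_in_image)
    then show "(\<integral>\<^sup>+x. labelled_pdf n (\<lambda>k. q (\<sigma> k)) x \<partial>multi_space M n) = 1"
      by (subst nn_integral_labelled_pdf) (auto simp: is_pdf_def)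
  qed
  also have "\<dots> = of_nat (fact n)"
    using card_permutes_Icc[of n] by simp
  finally show ?thesis
    using of_nat_fact_cancel[of n 1] by (simp add: fisst_integral_def)
qed

section \<open>Prediction\<close>

lemma is_pdf_target_predict:
  assumes "(\<lambda>(x, x'). trans_pdf x x') \<in> borel_measurable (M \<Otimes>\<^sub>M M)"
    and "\<And>x'. x' \<in> space M \<Longrightarrow> is_pdf M (\<lambda>x. trans_pdf x x')"
    and "is_pdf M (q k)"
  shows "is_pdf M (target_predict M trans_pdf q k)"
proof -
  interpret pair_sigma_finite M M by standard
  note [measurable] = assms(1)
  have [measurable]: "q k \<in> borel_measurable M" using assms(3) by (simp add: is_pdf_def)
  have "(\<integral>\<^sup>+x. target_predict M trans_pdf q k x \<partial>M)
      = (\<integral>\<^sup>+x'. \<integral>\<^sup>+x. trans_pdf x x' * q k x' \<partial>M \<partial>M)"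
    unfolding target_predict_def by (rule Fubini') measurable
  \<comment> \<open>After the exchange of integrals, the inner one runs over the new state
    \<open>x\<close> and equals one for each old state \<open>x'\<close>.\<close>
  also have "\<dots> = (\<integral>\<^sup>+x'. q k x' \<partial>M)"
    using assms(2) by (intro nn_integral_cong) (auto simp: nn_integral_multc is_pdf_def)
  finally show ?thesis
    using assms(3) unfolding is_pdf_def target_predict_def[abs_def] by simp
qed

lemma borel_measurable_fisst_trans:
  assumes "(\<lambda>(x, x'). trans_pdf x x') \<in> borel_measurable (M \<Otimes>\<^sub>M M)"
    and "x \<in> space (multi_space M n)"
  shows "fisst_trans trans_pdf n x \<in> borel_measurable (multi_space M n)"
  unfolding fisst_trans_def[abs_def]
proof (intro borel_measurable_sum borel_measurable_prod_ennreal)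
  fix \<sigma> k assume \<sigma>: "\<sigma> \<in> {\<sigma>. \<sigma> permutes {1..n}}" and k: "k \<in> {1..n}"
  then have "\<sigma> k \<in> {1..n}" by (metis mem_Collect_eq permutes_in_image)
  moreover have "x k \<in> space M" using assms(2) k by (auto simp: space_PiM)
  then have "trans_pdf (x k) \<in> borel_measurable M"
    using measurable_Pair2[OF assms(1)] by simp
  ultimately show "(\<lambda>x'. trans_pdf (x k) (x' (\<sigma> k))) \<in> borel_measurable (multi_space M n)"
    by (intro measurable_compose[OF measurable_component_singleton])
qed

text \<open>Once one permutation is fixed for the transition and one for the prior, the integrand is
  a product with one factor per coordinate of \<open>x'\<close>, so the multi-target integral splits
  into single-target predictions.\<close>

lemma fisst_predict_fisst_pdf:
  assumes trans: "(\<lambda>(x, x'). trans_pdf x x') \<in> borel_measurable (M \<Otimes>\<^sub>M M)"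
    and q: "\<And>k. k \<in> {1..n} \<Longrightarrow> q k \<in> borel_measurable M"
    and x: "x \<in> space (multi_space M n)"
  shows "fisst_predict M trans_pdf n (fisst_pdf n q) x = fisst_pdf n (target_predict M trans_pdf q) x"
proof -
  let ?S = "{\<sigma>. \<sigma> permutes {1..n}}"
  \<comment> \<open>All dependence on the coordinate \<open>x' k\<close> is collected here: under
    \<open>\<sigma>\<close>, the new state whose predecessor is \<open>x' k\<close> has index
    \<open>inv \<sigma> k\<close>.\<close>
  let ?r = "\<lambda>\<sigma> \<tau> k x'. trans_pdf (x (inv \<sigma> k)) x' * q (\<tau> k) x'"
  have factor: "?r \<sigma> \<tau> k \<in> borel_measurable M"
    if "\<sigma> \<in> ?S" "\<tau> \<in> ?S" "k \<in> {1..n}" for \<sigma> \<tau> k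
  proof -
    have "inv \<sigma> k \<in> {1..n}" "\<tau> k \<in> {1..n}"
      using that by (auto simp: permutes_in_image[OF permutes_inv, of \<sigma> "{1..n}", simplified]
          permutes_in_image[of \<tau> "{1..n}", simplified])
    moreover from this have "x (inv \<sigma> k) \<in> space M" using x by (auto simp: space_PiM)
    then have "trans_pdf (x (inv \<sigma> k)) \<in> borel_measurable M"
      using measurable_Pair2[OF trans] by simp
    ultimately show ?thesis using q by measurable
  qed
  have "(\<integral>\<^sup>+x'. fisst_trans trans_pdf n x x' * fisst_pdf n q x' \<partial>multi_space M n)
      = (\<integral>\<^sup>+x'. (\<Sum>\<sigma>\<in>?S. \<Sum>\<tau>\<in>?S. labelled_pdf n (?r \<sigma> \<tau>) x') \<partial>multi_space M n)"
  proof (intro nn_integral_cong)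
    fix x' :: "nat \<Rightarrow> 'a"
    have "(\<Prod>k\<in>{1..n}. trans_pdf (x k) (x' (\<sigma> k))) = (\<Prod>k\<in>{1..n}. trans_pdf (x (inv \<sigma> k)) (x' k))"
      if "\<sigma> permutes {1..n}" for \<sigma>
      by (subst prod.permute[OF that, of "\<lambda>k. trans_pdf (x (inv \<sigma> k)) (x' k)"])
        (simp add: permutes_inverses[OF that])
    then show "fisst_trans trans_pdf n x x' * fisst_pdf n q x'
        = (\<Sum>\<sigma>\<in>?S. \<Sum>\<tau>\<in>?S. labelled_pdf n (?r \<sigma> \<tau>) x')"
      unfolding fisst_trans_def fisst_pdf_def labelled_pdf_def sum_product
      by (intro sum.cong refl) (simp add: prod.distrib)
  qed
  also have "\<dots> = (\<Sum>\<sigma>\<in>?S. \<Sum>\<tau>\<in>?S. \<integral>\<^sup>+x'. labelled_pdf n (?r \<sigma> \<tau>) x' \<partial>multi_space M n)"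
  proof -
    have "labelled_pdf n (?r \<sigma> \<tau>) \<in> borel_measurable (multi_space M n)"
      if "\<sigma> \<in> ?S" "\<tau> \<in> ?S" for \<sigma> \<tau>
      by (rule borel_measurable_labelled_pdf) (rule factor[OF that])
    then show ?thesis
      by (subst nn_integral_sum) (auto intro!: sum.cong nn_integral_sum)
  qed
  also have "\<dots> = (\<Sum>\<sigma>\<in>?S. \<Sum>\<tau>\<in>?S. \<Prod>k\<in>{1..n}. target_predict M trans_pdf q (\<tau> k) (x (inv \<sigma> k)))"
    unfolding target_predict_def
    by (intro sum.cong refl nn_integral_labelled_pdf) (rule factor)
  \<comment> \<open>Reindexing the product by \<open>\<sigma>\<close> leaves only the composite
    \<open>\<tau> \<circ> \<sigma>\<close>. As \<open>\<tau>\<close> varies, so does the composite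
    over all permutations, hence the inner sum does not depend on \<open>\<sigma>\<close>.\<close>
  also have "\<dots> = (\<Sum>\<sigma>\<in>?S. fisst_pdf n (target_predict M trans_pdf q) x)"
  proof (intro sum.cong refl)
    fix \<sigma> assume "\<sigma> \<in> ?S"
    then have \<sigma>: "\<sigma> permutes {1..n}" by simp
    have "(\<Sum>\<tau>\<in>?S. \<Prod>k\<in>{1..n}. target_predict M trans_pdf q (\<tau> k) (x (inv \<sigma> k)))
        = (\<Sum>\<tau>\<in>?S. \<Prod>k\<in>{1..n}. target_predict M trans_pdf q ((\<tau> \<circ> \<sigma>) k) (x k))"
      by (intro sum.cong refl, subst prod.permute[OF \<sigma>]) (simp add: permutes_inverses[OF \<sigma>])
    also have "\<dots> = fisst_pdf n (target_predict M trans_pdf q) x"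
      unfolding fisst_pdf_def
      by (rule sum_permutations_compose_right[OF \<sigma>, symmetric])
    finally show "(\<Sum>\<tau>\<in>?S. \<Prod>k\<in>{1..n}. target_predict M trans_pdf q (\<tau> k) (x (inv \<sigma> k)))
        = fisst_pdf n (target_predict M trans_pdf q) x" .
  qed
  also have "\<dots> = of_nat (fact n) * fisst_pdf n (target_predict M trans_pdf q) x"
    using card_permutes_Icc[of n] by simp
  finally show ?thesis
    by (simp only: fisst_predict_def fisst_integral_def of_nat_fact_cancel)
qed

text \<open>Linearity of the integral: predicting the prior as a whole amounts to predicting each
  component and keeping its weight.\<close>

lemma fisst_predict_mixture:
  assumes "(\<lambda>(x, x'). trans_pdf x x') \<in> borel_measurable (M \<Otimes>\<^sub>M M)"
    and P: "\<And>i. i \<in> I \<Longrightarrow> P i \<in> borel_measurable (multi_space M n)"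
    and "x \<in> space (multi_space M n)"
  shows "fisst_predict M trans_pdf n (mixture I \<omega> P) x
    = mixture I \<omega> (\<lambda>i. fisst_predict M trans_pdf n (P i)) x"
proof -
  note [measurable] = borel_measurable_fisst_trans[OF assms(1,3)]
  have "(\<integral>\<^sup>+x'. fisst_trans trans_pdf n x x' * mixture I \<omega> P x' \<partial>multi_space M n)
      = (\<integral>\<^sup>+x'. (\<Sum>i\<in>I. ennreal (\<omega> i) * (fisst_trans trans_pdf n x x' * P i x')) \<partial>multi_space M n)"
    by (simp add: mixture_def sum_distrib_left mult_ac)
  also have "\<dots> = (\<Sum>i\<in>I. \<integral>\<^sup>+x'. ennreal (\<omega> i) * (fisst_trans trans_pdf n x x' * P i x') \<partial>multi_space M n)"
    using P by (intro nn_integral_sum) measurable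
  also have "\<dots> = (\<Sum>i\<in>I. ennreal (\<omega> i) * (\<integral>\<^sup>+x'. fisst_trans trans_pdf n x x' * P i x' \<partial>multi_space M n))"
    using P by (intro sum.cong refl nn_integral_cmult) measurable
  finally show ?thesis
    by (simp add: fisst_predict_def fisst_integral_def mixture_def sum_distrib_left mult_ac)
qed

end

section \<open>Relabelling targets in data associations\<close>

lemma relabel_data_assocs:
  assumes "\<sigma> permutes {1..n}" "j \<in> data_assocs n m"
  shows "map_option \<sigma> \<circ> j \<in> data_assocs n m"
proof -
  have "ran (map_option \<sigma> \<circ> j) = \<sigma> ` ran j"
    by (auto simp: ran_def)
  moreover have "inj_on (map_option \<sigma> \<circ> j) (dom j)"
    using assms inj_on_subset[OF option.inj_map[OF permutes_inj[OF assms(1)]] subset_UNIV]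
    by (intro comp_inj_on) (auto simp: data_assocs_def)
  moreover have "dom (map_option \<sigma> \<circ> j) = dom j"
    by (auto simp: dom_def)
  ultimately show ?thesis
    using assms permutes_image[OF assms(1)] image_mono[of "ran j" "{1..n}" \<sigma>] by (auto simp: data_assocs_def)
qed

text \<open>The term of \<open>j\<close> at the permuted state is the term of
  \<open>map_option \<sigma> \<circ> j\<close> at the original state. Relabelling keeps
  \<open>dom j\<close>, hence the clutter factors and, through its cardinality,
  \<open>assoc_prob\<close>; it is a bijection with inverse given by
  \<open>inv \<sigma>\<close>.\<close>

lemma fisst_lik_permute:
  assumes "\<sigma> permutes {1..n}"
  shows "fisst_lik lik g pD n m z (\<lambda>k. x (\<sigma> k)) = fisst_lik lik g pD n m z x"
proof -
  have dom: "dom (map_option \<sigma> \<circ> j) = dom j" for j :: "nat \<rightharpoonup> nat"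
    by (auto simp: dom_def)
  have cancel: "map_option \<sigma> \<circ> (map_option (inv \<sigma>) \<circ> j) = j"
    "map_option (inv \<sigma>) \<circ> (map_option \<sigma> \<circ> j) = j" for j :: "nat \<rightharpoonup> nat"
    by (simp_all add: fun_eq_iff option.map_comp permutes_inv_o[OF assms] option.map_id)
  have "bij_betw ((\<circ>) (map_option \<sigma>)) (data_assocs n m) (data_assocs n m)"
    by (rule bij_betw_byWitness[where f' = "(\<circ>) (map_option (inv \<sigma>))"])
      (use cancel relabel_data_assocs assms permutes_inv[OF assms] in auto)
  then show ?thesis
    unfolding fisst_lik_def
    by (subst sum.reindex_bij_betw[symmetric, where h = "(\<circ>) (map_option \<sigma>)"])
      (auto simp: dom assoc_prob_def option.map_sel domIff intro!: sum.cong prod.cong arg_cong2[where f = "(*)"])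
qed

section \<open>Single-target and labelled updates under one association\<close>

lemma target_update_assigned:
  assumes "j \<in> data_assocs n m" "j l = Some k"
  shows "target_update M lik z q j k x = lik (z l) x * q k x / (\<integral>\<^sup>+x'. lik (z l) x' * q k x' \<partial>M)"
proof -
  \<comment> \<open>An association is injective on its domain, so no other measurement is assigned
    to \<open>k\<close>.\<close>
  have "(THE l. j l = Some k) = l"
    using assms by (intro the_equality) (auto simp: data_assocs_def inj_on_def dom_def)
  moreover have "k \<in> ran j" using assms(2) by (rule ranI)
  ultimately show ?thesis by (simp add: target_update_def)
qed

lemma is_pdf_target_update:
  assumes j: "j \<in> data_assocs n m" and "is_pdf M (q k)"
    and lik: "\<And>l. l \<in> {1..m} \<Longrightarrow> lik (z l) \<in> borel_measurable M"
    and pos: "\<And>l. l \<in> {1..m} \<Longrightarrow> 0 < (\<integral>\<^sup>+x. lik (z l) x * q k x \<partial>M)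
      \<and> (\<integral>\<^sup>+x. lik (z l) x * q k x \<partial>M) < \<infinity>"
  shows "is_pdf M (target_update M lik z q j k)"
proof (cases "k \<in> ran j")
  case True
  then obtain l where l: "j l = Some k" by (auto simp: ran_def)
  then have lm: "l \<in> {1..m}" using j by (auto simp: data_assocs_def)
  note [measurable] = lik[OF lm]
  have [measurable]: "q k \<in> borel_measurable M" using assms(2) by (simp add: is_pdf_def)
  show ?thesis
    \<comment> \<open>The bounds in \<open>pos\<close> matter: in \<open>ennreal\<close> both
      \<open>0 / 0\<close> and the quotient of infinity by itself are 0, not 1.\<close>
    using pos[OF lm] unfolding is_pdf_def target_update_assigned[OF j l, abs_def]
    by (auto simp: nn_integral_divide intro!: ennreal_divide_self)
next
  case False
  then show ?thesis using assms(2) by (simp add: target_update_def[abs_def])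
qed

text \<open>Bayes' rule target by target: for a detected target, likelihood times prior is the
  evidence integral times the normalized posterior. The evidence integrals together with the clutter
  factors form \<open>hyp_lik\<close>, while undetected targets keep their factor.\<close>

lemma assoc_lik_labelled_pdf:
  assumes j: "j \<in> data_assocs n m"
    and pos: "\<And>k l. k \<in> {1..n} \<Longrightarrow> l \<in> {1..m} \<Longrightarrow> 0 < (\<integral>\<^sup>+x. lik (z l) x * q k x \<partial>M)
      \<and> (\<integral>\<^sup>+x. lik (z l) x * q k x \<partial>M) < \<infinity>"
  shows "(\<Prod>l\<in>dom j. lik (z l) (y (the (j l)))) * (\<Prod>l\<in>{1..m} - dom j. g (z l)) * labelled_pdf n q y
    = hyp_lik M lik g m z q j * labelled_pdf n (target_update M lik z q j) y"
proof -
  have ran: "ran j = (\<lambda>l. the (j l)) ` dom j" by (force simp: ran_def dom_def image_iff)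
  have inj: "inj_on (\<lambda>l. the (j l)) (dom j)"
    using j by (auto simp: data_assocs_def inj_on_def dom_def)
  have sub: "ran j \<subseteq> {1..n}" using j by (simp add: data_assocs_def)
  \<comment> \<open>Since \<open>the (j l)\<close> maps \<open>dom j\<close> bijectively onto
    \<open>ran j\<close>, the detected targets can be indexed by their measurements.\<close>
  have split: "labelled_pdf n r y
      = (\<Prod>l\<in>dom j. r (the (j l)) (y (the (j l)))) * (\<Prod>k\<in>{1..n} - ran j. r k (y k))" for r
    unfolding labelled_pdf_def
    by (subst prod.subset_diff[OF sub]) (simp_all add: ran prod.reindex[OF inj] mult.commute)
  let ?L = "\<lambda>l. \<integral>\<^sup>+x. lik (z l) x * q (the (j l)) x \<partial>M"
  have "(\<Prod>l\<in>dom j. ?L l) * (\<Prod>l\<in>dom j. target_update M lik z q j (the (j l)) (y (the (j l))))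
      = (\<Prod>l\<in>dom j. lik (z l) (y (the (j l)))) * (\<Prod>l\<in>dom j. q (the (j l)) (y (the (j l))))"
    unfolding prod.distrib[symmetric]
  proof (intro prod.cong refl)
    fix l assume "l \<in> dom j"
    then obtain k where k: "j l = Some k" by auto
    then have "k \<in> {1..n}" "l \<in> {1..m}" using j sub by (auto simp: data_assocs_def intro: ranI)
    then have "0 < ?L l" "?L l < \<infinity>" using pos[of k l] k by auto
    \<comment> \<open>The value \<open>a\<close> may be infinite; it is the evidence
      \<open>?L l\<close> that must be positive and finite.\<close>
    then have "?L l * (a / ?L l) = a" for a
      by (subst ennreal_times_divide, subst mult.commute) (simp add: mult_divide_eq_ennreal)
    then show "?L l * target_update M lik z q j (the (j l)) (y (the (j l)))
        = lik (z l) (y (the (j l))) * q (the (j l)) (y (the (j l)))"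
      using k by (simp add: target_update_assigned[OF j k])
  qed
  moreover have "(\<Prod>k\<in>{1..n} - ran j. target_update M lik z q j k (y k)) = (\<Prod>k\<in>{1..n} - ran j. q k (y k))"
    by (intro prod.cong) (auto simp: target_update_def)
  \<comment> \<open>Here \<open>a\<close> and \<open>b\<close> are likelihoods and priors of
    detected targets, \<open>u\<close> and \<open>v\<close> their evidences and posteriors,
    \<open>c\<close> the clutter product, and \<open>d\<close>, \<open>d'\<close> the undetected
    targets before and after the update.\<close>
  moreover have "a * c * (b * d) = u * c * (v * d')" if "u * v = a * b" "d' = d" for a b c d u v d' :: ennreal
    using that by (metis mult.assoc mult.left_commute)
  ultimately show ?thesis
    unfolding split hyp_lik_def by blast
qed

section \<open>The FISST update, for one component and for the normalized mixture\<close>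

lemma fisst_lik_fisst_pdf:
  assumes "\<And>k l. k \<in> {1..n} \<Longrightarrow> l \<in> {1..m} \<Longrightarrow> 0 < (\<integral>\<^sup>+x. lik (z l) x * q k x \<partial>M)
      \<and> (\<integral>\<^sup>+x. lik (z l) x * q k x \<partial>M) < \<infinity>"
  shows "fisst_lik lik g pD n m z x * fisst_pdf n q x
    = (\<Sum>j\<in>data_assocs n m. ennreal (assoc_prob pD n m j) * hyp_lik M lik g m z q j
        * fisst_pdf n (target_update M lik z q j) x)"
proof -
  let ?S = "{\<sigma>. \<sigma> permutes {1..n}}"
  \<comment> \<open>By symmetry the likelihood may be evaluated at the same permuted state as the
    labelled pdf, so that \<open>assoc_lik_labelled_pdf\<close> applies to each pair of permutation
    and association.\<close>
  have "fisst_lik lik g pD n m z x * fisst_pdf n q x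
      = (\<Sum>\<sigma>\<in>?S. fisst_lik lik g pD n m z (\<lambda>k. x (\<sigma> k)) * labelled_pdf n q (\<lambda>k. x (\<sigma> k)))"
    unfolding symmetrize_labelled_pdf[symmetric] symmetrize_def sum_distrib_left
    by (intro sum.cong refl) (simp add: fisst_lik_permute)
  also have "\<dots> = (\<Sum>\<sigma>\<in>?S. \<Sum>j\<in>data_assocs n m. ennreal (assoc_prob pD n m j) * hyp_lik M lik g m z q j
      * labelled_pdf n (target_update M lik z q j) (\<lambda>k. x (\<sigma> k)))"
    unfolding fisst_lik_def sum_distrib_right
  proof (intro sum.cong refl)
    fix \<sigma> j assume j: "j \<in> data_assocs n m"
    show "ennreal (assoc_prob pD n m j) * (\<Prod>l\<in>dom j. lik (z l) (x (\<sigma> (the (j l)))))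
          * (\<Prod>l\<in>{1..m} - dom j. g (z l)) * labelled_pdf n q (\<lambda>k. x (\<sigma> k))
        = ennreal (assoc_prob pD n m j) * hyp_lik M lik g m z q j
          * labelled_pdf n (target_update M lik z q j) (\<lambda>k. x (\<sigma> k))"
      using assoc_lik_labelled_pdf[where lik = lik and z = z and q = q and g = g
          and y = "\<lambda>k. x (\<sigma> k)", OF j assms]
      by (simp only: mult.assoc)
  qed
  also have "\<dots> = (\<Sum>j\<in>data_assocs n m. ennreal (assoc_prob pD n m j) * hyp_lik M lik g m z q j
        * fisst_pdf n (target_update M lik z q j) x)"
    by (subst sum.swap) (simp add: symmetrize_labelled_pdf[symmetric] symmetrize_def sum_distrib_left)
  finally show ?thesis .
qed

text \<open>\<open>P\<close> is compared with \<open>fisst_pdf\<close> on the product space only,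
  which is where the prediction formula is available. This is enough, as the normalizing integral
  and the point \<open>x\<close> see nothing outside it.\<close>

lemma (in sigma_finite_measure) fisst_update_fisst_pdf:
  assumes P: "\<And>i x. i \<in> I \<Longrightarrow> x \<in> space (multi_space M n) \<Longrightarrow> P i x = fisst_pdf n (Q i) x"
    and pdf: "\<And>i k. i \<in> I \<Longrightarrow> k \<in> {1..n} \<Longrightarrow> is_pdf M (Q i k)"
    and lik: "\<And>l. l \<in> {1..m} \<Longrightarrow> lik (z l) \<in> borel_measurable M"
    and pos: "\<And>i k l. i \<in> I \<Longrightarrow> k \<in> {1..n} \<Longrightarrow> l \<in> {1..m} \<Longrightarrow>
           0 < (\<integral>\<^sup>+x. lik (z l) x * Q i k x \<partial>M) \<and> (\<integral>\<^sup>+x. lik (z l) x * Q i k x \<partial>M) < \<infinity>"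
    and x: "x \<in> space (multi_space M n)"
  shows "fisst_update M lik g pD n m z I \<omega> P x
    = (\<Sum>i\<in>I. \<Sum>j\<in>data_assocs n m.
        ennreal (\<omega> i) * ennreal (assoc_prob pD n m j) * hyp_lik M lik g m z (Q i) j
          / total_weight M lik g pD n m z I \<omega> Q * fisst_pdf n (target_update M lik z (Q i) j) x)"
proof -
  let ?f = "\<lambda>x. \<Sum>i\<in>I. ennreal (\<omega> i) * fisst_lik lik g pD n m z x * P i x"
  let ?w = "\<lambda>i j. ennreal (\<omega> i) * ennreal (assoc_prob pD n m j) * hyp_lik M lik g m z (Q i) j"
  let ?u = "\<lambda>i j. fisst_pdf n (target_update M lik z (Q i) j)"
  have lik_Q: "fisst_lik lik g pD n m z x * fisst_pdf n (Q i) x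
      = (\<Sum>j\<in>data_assocs n m. ennreal (assoc_prob pD n m j) * hyp_lik M lik g m z (Q i) j * ?u i j x)"
    if "i \<in> I" for i x
    by (rule fisst_lik_fisst_pdf) (rule pos[OF that])
  have f: "?f x = (\<Sum>i\<in>I. \<Sum>j\<in>data_assocs n m. ?w i j * ?u i j x)"
    if "x \<in> space (multi_space M n)" for x
    by (intro sum.cong refl) (simp only: P[OF _ that] lik_Q mult.assoc sum_distrib_left)
  have upd: "is_pdf M (target_update M lik z (Q i) j k)"
    if "i \<in> I" "j \<in> data_assocs n m" "k \<in> {1..n}" for i j k
    using that by (intro is_pdf_target_update[where n = n and m = m] pdf lik pos)
  have meas: "?u i j \<in> borel_measurable (multi_space M n)"
    if "i \<in> I" "j \<in> data_assocs n m" for i j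
    by (intro borel_measurable_fisst_pdf) (use upd[OF that] in \<open>simp add: is_pdf_def\<close>)
  have integral_u: "fisst_integral M n (?u i j) = 1" if "i \<in> I" "j \<in> data_assocs n m" for i j
    by (rule fisst_integral_fisst_pdf) (rule upd[OF that])
  \<comment> \<open>Computation of the normalization factor: the weights \<open>?w i j\<close> come
    out of the integral, and each remaining \<open>?u i j\<close> has set integral one.\<close>
  have "(\<integral>\<^sup>+x. ?f x \<partial>multi_space M n)
      = (\<integral>\<^sup>+x. (\<Sum>i\<in>I. \<Sum>j\<in>data_assocs n m. ?w i j * ?u i j x) \<partial>multi_space M n)"
    by (intro nn_integral_cong f)
  also have "\<dots> = (\<Sum>i\<in>I. \<integral>\<^sup>+x. (\<Sum>j\<in>data_assocs n m. ?w i j * ?u i j x) \<partial>multi_space M n)"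
    by (intro nn_integral_sum borel_measurable_sum borel_measurable_times_ennreal borel_measurable_const meas)
  also have "\<dots> = (\<Sum>i\<in>I. \<Sum>j\<in>data_assocs n m. \<integral>\<^sup>+x. ?w i j * ?u i j x \<partial>multi_space M n)"
    by (intro sum.cong refl nn_integral_sum borel_measurable_times_ennreal borel_measurable_const meas)
  also have "\<dots> = (\<Sum>i\<in>I. \<Sum>j\<in>data_assocs n m. ?w i j * (\<integral>\<^sup>+x. ?u i j x \<partial>multi_space M n))"
    by (intro sum.cong refl nn_integral_cmult meas)
  finally have "fisst_integral M n ?f
      = (\<Sum>i\<in>I. \<Sum>j\<in>data_assocs n m. ?w i j * fisst_integral M n (?u i j))"
    by (simp add: fisst_integral_def sum_distrib_left mult_ac)
  also have "\<dots> = total_weight M lik g pD n m z I \<omega> Q"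
    unfolding total_weight_def
    by (intro sum.cong refl) (simp add: integral_u mult_ac)
  finally show ?thesis
    unfolding fisst_update_def fisst_normalize_def f[OF x]
    by (simp add: sum_distrib_left divide_ennreal_def mult_ac)
qed

section \<open>Agreement of the two recursions\<close>

theorem mainTheorem3:
  fixes M :: "'a measure"
    and I :: "'i set" and \<omega> :: "'i \<Rightarrow> real"
    and n m :: nat
    and p :: "'i \<Rightarrow> nat \<Rightarrow> 'a \<Rightarrow> ennreal"
    and trans_pdf :: "'a \<Rightarrow> 'a \<Rightarrow> ennreal"
    and lik :: "'z \<Rightarrow> 'a \<Rightarrow> ennreal" and g :: "'z \<Rightarrow> ennreal"
    and pD :: real and z :: "nat \<Rightarrow> 'z"
  assumes "sigma_finite_measure M"
    and "finite I" "\<And>i. i \<in> I \<Longrightarrow> 0 \<le> \<omega> i" "(\<Sum>i\<in>I. \<omega> i) = 1"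
    and "\<And>i k. i \<in> I \<Longrightarrow> k \<in> {1..n} \<Longrightarrow> is_pdf M (p i k)"
    and "(\<lambda>(x, x'). trans_pdf x x') \<in> borel_measurable (M \<Otimes>\<^sub>M M)"
    and "\<And>x'. x' \<in> space M \<Longrightarrow> is_pdf M (\<lambda>x. trans_pdf x x')"
    and "\<And>l. l \<in> {1..m} \<Longrightarrow> lik (z l) \<in> borel_measurable M"
    and "0 \<le> pD" "pD \<le> 1"
    and "\<And>i k l. i \<in> I \<Longrightarrow> k \<in> {1..n} \<Longrightarrow> l \<in> {1..m} \<Longrightarrow>
           0 < (\<integral>\<^sup>+x. lik (z l) x * target_predict M trans_pdf (p i) k x \<partial>M) \<and>
           (\<integral>\<^sup>+x. lik (z l) x * target_predict M trans_pdf (p i) k x \<partial>M) < \<infinity>"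
    and "0 < total_weight M lik g pD n m z I \<omega> (\<lambda>i. target_predict M trans_pdf (p i))"
    and "total_weight M lik g pD n m z I \<omega> (\<lambda>i. target_predict M trans_pdf (p i)) < \<infinity>"
  shows
    "(\<forall>i\<in>I. \<forall>x\<in>space (multi_space M n).
        fisst_predict M trans_pdf n (fisst_pdf n (p i)) x
          = (\<Sum>\<sigma> | \<sigma> permutes {1..n}. \<Prod>k\<in>{1..n}. target_predict M trans_pdf (p i) (\<sigma> k) (x k)))
     \<and>
     (\<forall>x\<in>space (multi_space M n).
        fisst_update M lik g pD n m z I \<omega> (\<lambda>i. fisst_predict M trans_pdf n (fisst_pdf n (p i))) x
          = (\<Sum>i\<in>I. \<Sum>j\<in>data_assocs n m.
               ennreal (\<omega> i) * ennreal (assoc_prob pD n m j)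
                 * hyp_lik M lik g m z (target_predict M trans_pdf (p i)) j
               / total_weight M lik g pD n m z I \<omega> (\<lambda>i. target_predict M trans_pdf (p i))
               * (\<Sum>\<sigma> | \<sigma> permutes {1..n}. \<Prod>k\<in>{1..n}.
                    target_update M lik z (target_predict M trans_pdf (p i)) j k (x (\<sigma> k)))))
     \<and>
     (\<forall>x\<in>space (multi_space M n).
        mixture I \<omega> (\<lambda>i. fisst_pdf n (p i)) x
          = mixture I \<omega> (\<lambda>i. symmetrize n (labelled_pdf n (p i))) x \<and>
        fisst_predict M trans_pdf n (mixture I \<omega> (\<lambda>i. fisst_pdf n (p i))) x
          = mixture I \<omega> (\<lambda>i. symmetrize n (labelled_pdf n (target_predict M trans_pdf (p i)))) x \<and>
        fisst_update M lik g pD n m z I \<omega> (\<lambda>i. fisst_predict M trans_pdf n (fisst_pdf n (p i))) x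
          = (\<Sum>h\<in>I \<times> data_assocs n m.
               let (w, F) = hfisst_update M lik g pD n m z I \<omega> (\<lambda>i. target_predict M trans_pdf (p i)) h
               in w * symmetrize n F x))"
proof -
  interpret sigma_finite_measure M by fact
  note trans = assms(6)
  let ?Q = "\<lambda>i. target_predict M trans_pdf (p i)"
  have p: "p i k \<in> borel_measurable M" if "i \<in> I" "k \<in> {1..n}" for i k
    using assms(5)[OF that] by (simp add: is_pdf_def)
  have predict: "fisst_predict M trans_pdf n (fisst_pdf n (p i)) x = fisst_pdf n (?Q i) x"
    if "i \<in> I" "x \<in> space (multi_space M n)" for i x
    by (rule fisst_predict_fisst_pdf[OF trans p[OF that(1)] that(2)])
  have pdf: "is_pdf M (?Q i k)" if "i \<in> I" "k \<in> {1..n}" for i k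
    by (rule is_pdf_target_predict) (use trans assms(7) assms(5)[OF that] in auto)
  \<comment> \<open>The components to be updated are the FISST predictions themselves;
    \<open>predict\<close> supplies their permutation form with the single-target predictions
    \<open>?Q i\<close>.\<close>
  note update = fisst_update_fisst_pdf[where I = I and n = n and m = m and lik = lik and z = z and Q = ?Q
      and P = "\<lambda>i. fisst_predict M trans_pdf n (fisst_pdf n (p i))", OF predict pdf assms(8) assms(11)]
  \<comment> \<open>The update formula to be shown permutes the arguments, whereas
    \<open>fisst_pdf\<close> permutes the labels.\<close>
  have sym: "(\<Sum>\<sigma> | \<sigma> permutes {1..n}. \<Prod>k\<in>{1..n}. q k (x (\<sigma> k))) = fisst_pdf n q x"
    for q and x :: "nat \<Rightarrow> 'a"
    using symmetrize_labelled_pdf[of n q x] by (simp add: symmetrize_def labelled_pdf_def)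
  show ?thesis
  proof (intro conjI ballI)
    fix i x assume "i \<in> I" "x \<in> space (multi_space M n)"
    then show "fisst_predict M trans_pdf n (fisst_pdf n (p i)) x
        = (\<Sum>\<sigma> | \<sigma> permutes {1..n}. \<Prod>k\<in>{1..n}. ?Q i (\<sigma> k) (x k))"
      by (simp add: predict fisst_pdf_def)
  next
    fix x assume x: "x \<in> space (multi_space M n)"
    show "fisst_update M lik g pD n m z I \<omega> (\<lambda>i. fisst_predict M trans_pdf n (fisst_pdf n (p i))) x
        = (\<Sum>i\<in>I. \<Sum>j\<in>data_assocs n m.
             ennreal (\<omega> i) * ennreal (assoc_prob pD n m j) * hyp_lik M lik g m z (?Q i) j
             / total_weight M lik g pD n m z I \<omega> ?Q
             * (\<Sum>\<sigma> | \<sigma> permutes {1..n}. \<Prod>k\<in>{1..n}. target_update M lik z (?Q i) j k (x (\<sigma> k))))"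
      unfolding sym by (rule update[OF _ _ _ _ _ _ _ _ x])
  next
    fix x assume x: "x \<in> space (multi_space M n)"
    show "mixture I \<omega> (\<lambda>i. fisst_pdf n (p i)) x
        = mixture I \<omega> (\<lambda>i. symmetrize n (labelled_pdf n (p i))) x"
      by (simp add: mixture_def symmetrize_labelled_pdf)
    have "fisst_predict M trans_pdf n (mixture I \<omega> (\<lambda>i. fisst_pdf n (p i))) x
        = mixture I \<omega> (\<lambda>i. fisst_predict M trans_pdf n (fisst_pdf n (p i))) x"
      by (intro fisst_predict_mixture trans borel_measurable_fisst_pdf p x)
    then show "fisst_predict M trans_pdf n (mixture I \<omega> (\<lambda>i. fisst_pdf n (p i))) x
        = mixture I \<omega> (\<lambda>i. symmetrize n (labelled_pdf n (?Q i))) x"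
      using x by (simp add: mixture_def predict symmetrize_labelled_pdf)
    show "fisst_update M lik g pD n m z I \<omega> (\<lambda>i. fisst_predict M trans_pdf n (fisst_pdf n (p i))) x
        = (\<Sum>h\<in>I \<times> data_assocs n m.
             let (w, F) = hfisst_update M lik g pD n m z I \<omega> ?Q h in w * symmetrize n F x)"
      by (subst update[OF _ _ _ _ _ _ _ _ x])
        (simp_all add: sum.cartesian_product hfisst_update_def symmetrize_labelled_pdf case_prod_beta)
  qed
qed

end
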